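(* Let $G$ be a graph on $n$ vertices with degree sequence $d_1\le d_2\le\dots\le d_n$, and let $\tau$ be any threshold assignment for $G$ with average threshold $\bar t=\sum_v\tau(v)/n$. Then $$dyn_\tau(G)\le \max\Big\{k\in\{0,\dots,n\}: \sum_{i=1}^k(d_i+1)\le n\bar t\Big\}.$$ Consequently $Dyn_{\bar t=t}(G)\le \max\{k: \sum_{i=1}^k(d_i+1)\le nt\}$.
   Context: Graphs are finite, undirected, simple. A threshold assignment for $G$ is a function $\tau:V(G)\to\mathbb{N}\cup\{0\}$ with $\tau(v)\le \deg(v)$ for every $v$. For $M\subseteq V(G)$, the $\tau$-dynamic process starting from $M$ is $D_0=M$ and, for $i\ge0$, $D_{i+1}$ = set of vertices $v\notin D_0\cup\dots\cup D_i$ with at least $\tau(v)$ neighbours in $D_0\cup\dots\cup D_i$; $M$ is a $\tau$-dynamic monopoly if $\bigcup_i D_i=V(G)$. $dyn_\tau(G)$ is the minimum size of a $\tau$-dynamic monopoly, and $Dyn_{\bar t=t}(G)$ is the maximum of $dyn_\tau(G)$ over threshold assignments with average threshold $t$. *)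

theory Defs
  imports Complex_Main "HOL-Library.Multiset" "Graph_Theory.Digraph"
begin

text \<open>
  A finite simple undirected graph is a digraph satisfying the locale predicate \<^const>\<open>graph\<close>:
  finite, loop-free, without parallel arcs and symmetric, an edge being a pair of opposite arcs.
\<close>

definition neighbours :: "('a, 'b) pre_digraph \<Rightarrow> 'a \<Rightarrow> 'a set" where
  "neighbours G v = {u \<in> verts G. v \<rightarrow>\<^bsub>G\<^esub> u}"

definition deg :: "('a, 'b) pre_digraph \<Rightarrow> 'a \<Rightarrow> nat" where
  "deg G v = card (neighbours G v)"

text \<open>The \<open>i\<close>-th smallest degree, with indices running from 1 to the number of vertices.\<close>

definition deg_seq :: "('a, 'b) pre_digraph \<Rightarrow> nat \<Rightarrow> nat" where
  "deg_seq G i = sorted_list_of_multiset (image_mset (deg G) (mset_set (verts G))) ! (i - 1)"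

definition threshold_assignment :: "('a, 'b) pre_digraph \<Rightarrow> ('a \<Rightarrow> nat) \<Rightarrow> bool" where
  "threshold_assignment G \<tau> \<longleftrightarrow> (\<forall>v \<in> verts G. \<tau> v \<le> deg G v)"

definition avg_threshold :: "('a, 'b) pre_digraph \<Rightarrow> ('a \<Rightarrow> nat) \<Rightarrow> real" where
  "avg_threshold G \<tau> = (\<Sum>v \<in> verts G. real (\<tau> v)) / real (card (verts G))"

fun dynamic_process ::
  "('a, 'b) pre_digraph \<Rightarrow> ('a \<Rightarrow> nat) \<Rightarrow> 'a set \<Rightarrow> nat \<Rightarrow> 'a set" where
  "dynamic_process G \<tau> M 0 = M"
| "dynamic_process G \<tau> M (Suc i) =
     {v \<in> verts G. v \<notin> (\<Union>j \<in> {..i}. dynamic_process G \<tau> M j) \<and>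
        \<tau> v \<le> card (neighbours G v \<inter> (\<Union>j \<in> {..i}. dynamic_process G \<tau> M j))}"

definition dynamic_monopoly :: "('a, 'b) pre_digraph \<Rightarrow> ('a \<Rightarrow> nat) \<Rightarrow> 'a set \<Rightarrow> bool" where
  "dynamic_monopoly G \<tau> M \<longleftrightarrow>
     M \<subseteq> verts G \<and> (\<Union>i. dynamic_process G \<tau> M i) = verts G"

definition dyn :: "('a, 'b) pre_digraph \<Rightarrow> ('a \<Rightarrow> nat) \<Rightarrow> nat" where
  "dyn G \<tau> = Min {card M | M. dynamic_monopoly G \<tau> M}"

text \<open>
  Meaningful only if some threshold assignment has average \<open>t\<close>; otherwise the maximum ranges over
  the empty set.
\<close>

definition Dyn :: "('a, 'b) pre_digraph \<Rightarrow> real \<Rightarrow> nat" where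
  "Dyn G t = Max {dyn G \<tau> | \<tau>. threshold_assignment G \<tau> \<and> avg_threshold G \<tau> = t}"

end

theory Submission
  imports Defs
begin

text \<open>
  Put the vertices in a uniformly random order and let \<open>M\<close> consist of the vertices \<open>v\<close> preceded by
  fewer than \<open>\<tau> v\<close> of their neighbours. Activating the vertices in this order shows that \<open>M\<close> is a
  dynamic monopoly, and \<open>v\<close> lies in \<open>M\<close> with probability \<open>\<tau> v / (deg v + 1)\<close>, so the expectation
  of \<open>\<Sum>v\<in>M. deg v + 1\<close> is \<open>\<Sum>v. \<tau> v\<close>. Hence some monopoly \<open>M\<close> satisfies
  \<open>(\<Sum>v\<in>M. deg v + 1) \<le> n * t\<close>, and the left-hand side is at least the sum over the \<open>card M\<close>
  smallest degrees. The expectation argument is derandomised by choosing the last vertex of the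
  order first and inducting on the set of the remaining vertices.
\<close>

section \<open>Sums over the smallest degrees\<close>

text \<open>Matching the head, which is the least entry, with one element of \<open>B\<close> leaves
  the other elements inside the tail, where the induction hypothesis applies.\<close>

lemma sum_list_take_sorted_le:
  fixes xs :: "'a :: {linorder, ordered_comm_monoid_add} list"
  assumes "sorted xs" and "B \<subseteq># mset xs"
  shows "sum_list (take (size B) xs) \<le> sum_mset B"
  using assms
proof (induction xs arbitrary: B)
  case Nil
  then show ?case by simp
next
  case (Cons x xs)
  show ?case
  proof (cases "B = {#}")
    case True
    then show ?thesis by simp
  next
    case False
    \<comment> \<open>Taking \<open>x\<close> itself whenever it occurs in \<open>B\<close> keeps
      the remainder inside the tail.\<close>
    obtain b where b: "b \<in># B" "x \<in># B \<Longrightarrow> b = x"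
      using False by (metis multiset_nonemptyE)
    have sub: "B - {#b#} \<subseteq># mset xs"
    proof (cases "x \<in># B")
      case True
      then show ?thesis
        using b Cons.prems(2) by (simp add: subset_eq_diff_conv)
    next
      case False
      then have "B \<subseteq># mset xs"
        using Cons.prems(2)
        by (metis add_mset_add_single diff_single_trivial mset.simps(2) subset_eq_diff_conv)
      then show ?thesis
        by (meson diff_subset_eq_self subset_mset.order_trans)
    qed
    have "x \<le> b"
      using mset_subset_eqD[OF Cons.prems(2) b(1)] Cons.prems(1) by auto
    moreover have "sum_list (take (size (B - {#b#})) xs) \<le> sum_mset (B - {#b#})"
      using Cons sub by simp
    moreover have "size B = Suc (size (B - {#b#}))"
      using b(1) by (simp add: size_Suc_Diff1)
    moreover have "sum_mset B = b + sum_mset (B - {#b#})"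
      using b(1) by (rule sum_mset.remove)
    ultimately show ?thesis
      by (simp add: add_mono)
  qed
qed

lemma sum_deg_seq_le_sum_deg:
  assumes "finite (verts G)" and "M \<subseteq> verts G"
  shows "(\<Sum>i = 1..card M. deg_seq G i + 1) \<le> (\<Sum>v\<in>M. deg G v + 1)"
proof -
  define L where "L = sorted_list_of_multiset (image_mset (deg G) (mset_set (verts G)))"
  define B where "B = image_mset (deg G) (mset_set M)"
  have len: "length L = card (verts G)"
    by (metis L_def mset_sorted_list_of_multiset size_image_mset size_mset size_mset_set)
  have card: "card M \<le> length L"
    using len assms by (simp add: card_mono)
  have "B \<subseteq># mset L"
    unfolding B_def L_def mset_sorted_list_of_multiset
    by (intro image_mset_subseteq_mono) (use assms in \<open>simp add: subset_imp_msubset_mset_set\<close>)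
  then have "sum_list (take (card M) L) \<le> sum_mset B"
    using sum_list_take_sorted_le[of L B] by (simp add: L_def B_def)
  moreover have "sum_mset B = (\<Sum>v\<in>M. deg G v)"
    by (simp add: B_def sum_unfold_sum_mset)
  moreover have "sum_list (take (card M) L) = (\<Sum>i = 1..card M. deg_seq G i)"
  proof -
    have "sum_list (take (card M) L) = (\<Sum>i<card M. L ! i)"
      using card by (simp add: sum_list_sum_nth lessThan_atLeast0 min_def)
    also have "\<dots> = (\<Sum>i = 1..card M. L ! (i - 1))"
      by (rule sum.reindex_bij_witness[of _ "\<lambda>i. i - 1" Suc]) auto
    finally show ?thesis by (simp add: deg_seq_def L_def)
  qed
  ultimately show ?thesis by (simp add: sum.distrib del: One_nat_def)
qed

section \<open>Expected seed weight in a random order\<close>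

text \<open>
  The probability that, in a random order of a vertex and its \<open>d\<close> neighbours, fewer than \<open>t\<close>
  neighbours come before the vertex.
\<close>

definition seed_prob :: "nat \<Rightarrow> nat \<Rightarrow> real" where
  "seed_prob t d = real (min t (d + 1)) / real (d + 1)"

text \<open>
  Condition on whether the vertex, one of its \<open>d\<close> neighbours or one of the remaining vertices of
  an \<open>s\<close>-element set comes last.
\<close>

lemma seed_prob_condition_last:
  assumes "d < s"
  shows "(if t \<le> d then 0 else 1) + real d * seed_prob t (d - 1)
           + (real s - 1 - real d) * seed_prob t d = real s * seed_prob t d"
proof -
  \<comment> \<open>For \<open>d = 0\<close> the truncated \<open>d - 1\<close> is harmless, since
    its term carries the factor zero.\<close>
  have "real d * seed_prob t (d - 1) = real (min t d)"
    by (cases d) (simp_all add: seed_prob_def)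
  moreover have "(real d + 1) * seed_prob t d = real (min t (d + 1))"
    by (simp add: seed_prob_def add.commute)
  \<comment> \<open>Raising the cap from \<open>d\<close> to \<open>d + 1\<close> increases the
    minimum exactly when \<open>t > d\<close>; so the first two summands of the goal make up
    \<open>(d + 1) * seed_prob t d\<close>.\<close>
  moreover have "(if t \<le> d then 0 else 1) + real (min t d) = real (min t (d + 1))"
    by auto
  ultimately show ?thesis by (simp add: algebra_simps)
qed

text \<open>Expectation for a random order of \<open>S\<close> alone, where only neighbours inside
  \<open>S\<close> can precede a vertex. As \<open>S\<close> shrinks, this inner degree may fall far
  below the threshold, hence the truncation in \<open>seed_prob\<close>.\<close>

definition expected_seed_weight ::
  "('a \<Rightarrow> 'a set) \<Rightarrow> ('a \<Rightarrow> nat) \<Rightarrow> ('a \<Rightarrow> real) \<Rightarrow> 'a set \<Rightarrow> real" where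
  "expected_seed_weight N \<tau> w S = (\<Sum>v\<in>S. w v * seed_prob (\<tau> v) (card (N v \<inter> S)))"

text \<open>Law of total expectation over the last vertex \<open>v\<close>, multiplied by
  \<open>card S\<close>. The last vertex follows all its neighbours in \<open>S\<close>, so it is a
  seed exactly when these are fewer than \<open>\<tau> v\<close>.\<close>

lemma expected_seed_weight_average:
  assumes "finite S" and irrefl: "\<And>v. v \<in> S \<Longrightarrow> v \<notin> N v"
  shows "(\<Sum>v\<in>S. (if \<tau> v \<le> card (N v \<inter> S) then 0 else w v)
            + expected_seed_weight N \<tau> w (S - {v}))
         = real (card S) * expected_seed_weight N \<tau> w S"
proof -
  \<comment> \<open>The contribution of a fixed \<open>u\<close>, collected over all choices of the
    last vertex.\<close>
  have one: "(if \<tau> u \<le> card (N u \<inter> S) then 0 else w u)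
      + (\<Sum>v\<in>S - {u}. w u * seed_prob (\<tau> u) (card (N u \<inter> (S - {v}))))
      = real (card S) * (w u * seed_prob (\<tau> u) (card (N u \<inter> S)))" if u: "u \<in> S" for u
  proof -
    define d where "d = card (N u \<inter> S)"
    have "N u \<inter> S \<subset> S" using u irrefl by auto
    then have ds: "d < card S" unfolding d_def using assms(1) psubset_card_mono by blast
    have split: "S - {u} = (N u \<inter> S) \<union> (S - {u} - N u)" using irrefl u by auto
    have "card (S - {u}) = card (N u \<inter> S) + card (S - {u} - N u)"
      by (subst split, rule card_Un_disjoint) (use assms(1) in auto)
    then have cc: "real (card (S - {u} - N u)) = real (card S) - 1 - real d"
      using u assms(1) ds by (simp add: d_def card_Diff_singleton)
    have "(\<Sum>v\<in>S - {u}. seed_prob (\<tau> u) (card (N u \<inter> (S - {v}))))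
       = (\<Sum>v\<in>N u \<inter> S. seed_prob (\<tau> u) (card (N u \<inter> (S - {v}))))
       + (\<Sum>v\<in>S - {u} - N u. seed_prob (\<tau> u) (card (N u \<inter> (S - {v}))))"
      by (subst split, rule sum.union_disjoint) (use assms(1) in auto)
    also have "(\<Sum>v\<in>N u \<inter> S. seed_prob (\<tau> u) (card (N u \<inter> (S - {v}))))
       = (\<Sum>v\<in>N u \<inter> S. seed_prob (\<tau> u) (d - 1))"
    proof (rule sum.cong[OF refl])
      fix v assume "v \<in> N u \<inter> S"
      moreover have "N u \<inter> (S - {v}) = (N u \<inter> S) - {v}" by auto
      ultimately show "seed_prob (\<tau> u) (card (N u \<inter> (S - {v}))) = seed_prob (\<tau> u) (d - 1)"
        by (simp add: d_def card_Diff_singleton)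
    qed
    also have "\<dots> = real d * seed_prob (\<tau> u) (d - 1)" by (simp add: d_def)
    also have "(\<Sum>v\<in>S - {u} - N u. seed_prob (\<tau> u) (card (N u \<inter> (S - {v}))))
       = (\<Sum>v\<in>S - {u} - N u. seed_prob (\<tau> u) d)"
    proof (rule sum.cong[OF refl])
      fix v assume "v \<in> S - {u} - N u"
      then have "N u \<inter> (S - {v}) = N u \<inter> S" by auto
      then show "seed_prob (\<tau> u) (card (N u \<inter> (S - {v}))) = seed_prob (\<tau> u) d"
        by (simp add: d_def)
    qed
    also have "\<dots> = (real (card S) - 1 - real d) * seed_prob (\<tau> u) d"
      using cc by simp
    finally have eq: "(\<Sum>v\<in>S - {u}. seed_prob (\<tau> u) (card (N u \<inter> (S - {v}))))
       = real d * seed_prob (\<tau> u) (d - 1) + (real (card S) - 1 - real d) * seed_prob (\<tau> u) d" .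
    have "(if \<tau> u \<le> d then 0 else w u)
        + w u * (\<Sum>v\<in>S - {u}. seed_prob (\<tau> u) (card (N u \<inter> (S - {v}))))
      = w u * ((if \<tau> u \<le> d then 0 else 1) + real d * seed_prob (\<tau> u) (d - 1)
           + (real (card S) - 1 - real d) * seed_prob (\<tau> u) d)"
      unfolding eq by (simp add: algebra_simps)
    also have "\<dots> = w u * (real (card S) * seed_prob (\<tau> u) d)"
      using seed_prob_condition_last[OF ds] by simp
    finally show ?thesis by (simp add: sum_distrib_left d_def)
  qed
  \<comment> \<open>The summations are exchanged: the set of ordered pairs of distinct elements of
    \<open>S\<close> is symmetric.\<close>
  have "(\<Sum>v\<in>S. expected_seed_weight N \<tau> w (S - {v}))
      = (\<Sum>u\<in>S. \<Sum>v\<in>S - {u}. w u * seed_prob (\<tau> u) (card (N u \<inter> (S - {v}))))"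
    unfolding expected_seed_weight_def sum.Sigma[OF assms(1) ballI, OF finite_Diff[OF assms(1)]]
    by (rule sum.reindex_bij_witness[of _ "\<lambda>(x, y). (y, x)" "\<lambda>(x, y). (y, x)"]) auto
  then have "(\<Sum>v\<in>S. (if \<tau> v \<le> card (N v \<inter> S) then 0 else w v)
            + expected_seed_weight N \<tau> w (S - {v}))
      = (\<Sum>u\<in>S. (if \<tau> u \<le> card (N u \<inter> S) then 0 else w u)
            + (\<Sum>v\<in>S - {u}. w u * seed_prob (\<tau> u) (card (N u \<inter> (S - {v})))))"
    by (simp only: sum.distrib)
  also have "\<dots> = real (card S) * expected_seed_weight N \<tau> w S"
    unfolding expected_seed_weight_def sum_distrib_left by (rule sum.cong[OF refl one])
  finally show ?thesis .
qed

section \<open>Percolating sets of small weight\<close>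

text \<open>Method of conditional expectations. Phrasing percolation through sets \<open>X\<close>
  closed under activation avoids stages, and \<open>X\<close> can later be the union of the whole
  process.\<close>

lemma exists_percolating_set_weight_le:
  assumes "finite S" and irrefl: "\<And>v. v \<in> S \<Longrightarrow> v \<notin> N v"
    and finN: "\<And>v. v \<in> S \<Longrightarrow> finite (N v)"
  shows "\<exists>M\<subseteq>S. sum w M \<le> expected_seed_weight N \<tau> w S \<and>
    (\<forall>X. M \<subseteq> X \<longrightarrow> (\<forall>v\<in>S. \<tau> v \<le> card (N v \<inter> X) \<longrightarrow> v \<in> X) \<longrightarrow> S \<subseteq> X)"
  using assms
proof (induction S rule: finite_psubset_induct)
  case (psubset S)
  show ?case
  proof (cases "S = {}")
    case True
    then show ?thesis by (simp add: expected_seed_weight_def)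
  next
    case False
    let ?c = "\<lambda>v. if \<tau> v \<le> card (N v \<inter> S) then 0 else w v"
    \<comment> \<open>Not every choice of the last vertex can exceed the average.\<close>
    have "\<exists>v\<in>S. ?c v + expected_seed_weight N \<tau> w (S - {v}) \<le> expected_seed_weight N \<tau> w S"
    proof (rule ccontr)
      assume "\<not> ?thesis"
      then have gt: "expected_seed_weight N \<tau> w S < ?c v + expected_seed_weight N \<tau> w (S - {v})"
        if "v \<in> S" for v
        using that by (meson not_le)
      have "(\<Sum>v\<in>S. expected_seed_weight N \<tau> w S)
          < (\<Sum>v\<in>S. ?c v + expected_seed_weight N \<tau> w (S - {v}))"
        by (rule sum_strict_mono) (use psubset.hyps False gt in auto)
      then show False
        using expected_seed_weight_average[of S N \<tau> w] psubset.hyps psubset.prems by simp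
    qed
    then obtain v where v: "v \<in> S"
      and le: "?c v + expected_seed_weight N \<tau> w (S - {v}) \<le> expected_seed_weight N \<tau> w S"
      by blast
    obtain M where M: "M \<subseteq> S - {v}" "sum w M \<le> expected_seed_weight N \<tau> w (S - {v})"
      and perc: "\<And>X. M \<subseteq> X \<Longrightarrow> (\<forall>u\<in>S - {v}. \<tau> u \<le> card (N u \<inter> X) \<longrightarrow> u \<in> X) \<Longrightarrow> S - {v} \<subseteq> X"
      using psubset.IH[of "S - {v}"] v psubset.prems by blast
    have finM: "finite M" using M(1) psubset.hyps by (meson finite_Diff finite_subset)
    show ?thesis
    proof (cases "\<tau> v \<le> card (N v \<inter> S)")
      case True
      have "S \<subseteq> X" if X: "M \<subseteq> X" "\<forall>u\<in>S. \<tau> u \<le> card (N u \<inter> X) \<longrightarrow> u \<in> X" for X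
      proof -
        \<comment> \<open>Once the rest of \<open>S\<close> is active, so are all neighbours of
          \<open>v\<close> in \<open>S\<close>, which suffices to activate \<open>v\<close>.\<close>
        have "S - {v} \<subseteq> X" using perc X by blast
        moreover from this have "N v \<inter> S \<subseteq> N v \<inter> X" using psubset.prems(1) v by blast
        \<comment> \<open>Finiteness of \<open>N v\<close> matters here, as \<open>card\<close> is 0
          on infinite sets.\<close>
        then have "card (N v \<inter> S) \<le> card (N v \<inter> X)"
          using psubset.prems(2)[OF v] by (simp add: card_mono)
        then have "v \<in> X" using True X(2) v by fastforce
        ultimately show ?thesis by blast
      qed
      then show ?thesis using M le True by (intro exI[of _ M]) auto
    next
      case False
      have "sum w (insert v M) = w v + sum w M" using M(1) finM by (subst sum.insert) auto
      then have "sum w (insert v M) \<le> expected_seed_weight N \<tau> w S"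
        using M(2) le False by simp
      moreover have "S \<subseteq> X"
        if "insert v M \<subseteq> X" "\<forall>u\<in>S. \<tau> u \<le> card (N u \<inter> X) \<longrightarrow> u \<in> X" for X
        using perc[of X] that by auto
      ultimately show ?thesis using M(1) v by (intro exI[of _ "insert v M"]) auto
    qed
  qed
qed

section \<open>From percolation to the dynamic process\<close>

lemma dynamic_process_subset_verts:
  "M \<subseteq> verts G \<Longrightarrow> dynamic_process G \<tau> M i \<subseteq> verts G"
  by (cases i) auto

text \<open>The finitely many active neighbours of \<open>v\<close> are all active by some common
  stage \<open>m\<close>, so \<open>v\<close> is activated at stage \<open>m + 1\<close> at the
  latest.\<close>

lemma dynamic_process_Union_closed:
  assumes "finite (verts G)" and "v \<in> verts G"
    and le: "\<tau> v \<le> card (neighbours G v \<inter> (\<Union>i. dynamic_process G \<tau> M i))"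
  shows "v \<in> (\<Union>i. dynamic_process G \<tau> M i)"
proof -
  let ?A = "neighbours G v \<inter> (\<Union>i. dynamic_process G \<tau> M i)"
  have fin: "finite ?A" using assms(1) by (simp add: neighbours_def)
  have "\<forall>u\<in>?A. \<exists>i. u \<in> dynamic_process G \<tau> M i" by auto
  then obtain f where f: "\<And>u. u \<in> ?A \<Longrightarrow> u \<in> dynamic_process G \<tau> M (f u)" by metis
  \<comment> \<open>If \<open>?A\<close> is empty, this maximum is unspecified, but then any
    \<open>m\<close> will do.\<close>
  define m where "m = Max (f ` ?A)"
  have m: "f u \<le> m" if "u \<in> ?A" for u
    unfolding m_def by (rule Max_ge[OF finite_imageI[OF fin] imageI[OF that]])
  have "?A = neighbours G v \<inter> (\<Union>j\<in>{..m}. dynamic_process G \<tau> M j)"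
    using f m by (auto simp del: dynamic_process.simps)
  then have "v \<in> (\<Union>j\<in>{..m}. dynamic_process G \<tau> M j) \<or> v \<in> dynamic_process G \<tau> M (Suc m)"
    using le assms(2) by auto
  then show ?thesis by blast
qed

lemma exists_dynamic_monopoly_sum_deg_le:
  assumes "graph G"
  shows "\<exists>M. dynamic_monopoly G \<tau> M \<and> (\<Sum>v\<in>M. deg G v + 1) \<le> (\<Sum>v\<in>verts G. \<tau> v)"
proof -
  interpret graph G by fact
  \<comment> \<open>This weight cancels the denominator of \<open>seed_prob\<close>, so each vertex
    contributes \<open>min (\<tau> v) (deg G v + 1)\<close>, hence at most
    \<open>\<tau> v\<close>.\<close>
  define w where "w = (\<lambda>v. real (deg G v + 1))"
  have inter: "neighbours G v \<inter> verts G = neighbours G v" for v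
    by (auto simp: neighbours_def)
  have "\<exists>M\<subseteq>verts G. sum w M \<le> expected_seed_weight (neighbours G) \<tau> w (verts G) \<and>
    (\<forall>X. M \<subseteq> X \<longrightarrow> (\<forall>v\<in>verts G. \<tau> v \<le> card (neighbours G v \<inter> X) \<longrightarrow> v \<in> X) \<longrightarrow> verts G \<subseteq> X)"
    by (rule exists_percolating_set_weight_le) (auto simp: neighbours_def dest: adj_not_same)
  then obtain M where M: "M \<subseteq> verts G"
    and wt: "sum w M \<le> expected_seed_weight (neighbours G) \<tau> w (verts G)"
    and perc: "\<And>X. M \<subseteq> X \<Longrightarrow> (\<forall>v\<in>verts G. \<tau> v \<le> card (neighbours G v \<inter> X) \<longrightarrow> v \<in> X)
      \<Longrightarrow> verts G \<subseteq> X"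
    by blast
  have "M \<subseteq> (\<Union>i. dynamic_process G \<tau> M i)"
    using UN_upper[of 0 UNIV "dynamic_process G \<tau> M"] by simp
  then have "verts G \<subseteq> (\<Union>i. dynamic_process G \<tau> M i)"
    by (rule perc) (intro ballI impI dynamic_process_Union_closed finite_verts)
  moreover have "(\<Union>i. dynamic_process G \<tau> M i) \<subseteq> verts G"
    by (intro UN_least dynamic_process_subset_verts M)
  ultimately have "dynamic_monopoly G \<tau> M"
    using M by (simp add: dynamic_monopoly_def)
  moreover have "expected_seed_weight (neighbours G) \<tau> w (verts G) \<le> (\<Sum>v\<in>verts G. real (\<tau> v))"
    unfolding expected_seed_weight_def inter
    by (rule sum_mono) (simp add: w_def seed_prob_def deg_def del: of_nat_add of_nat_Suc)
  then have "real (\<Sum>v\<in>M. deg G v + 1) \<le> real (\<Sum>v\<in>verts G. \<tau> v)"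
    using wt by (simp add: w_def)
  then have "(\<Sum>v\<in>M. deg G v + 1) \<le> (\<Sum>v\<in>verts G. \<tau> v)"
    by (simp only: of_nat_le_iff)
  ultimately show ?thesis by blast
qed

section \<open>Bounds on \<open>dyn\<close> and \<open>Dyn\<close>\<close>

lemma dyn_le_card:
  assumes "finite (verts G)" and "dynamic_monopoly G \<tau> M"
  shows "dyn G \<tau> \<le> card M"
proof -
  have "{card M | M. dynamic_monopoly G \<tau> M} \<subseteq> card ` Pow (verts G)"
    by (auto simp: dynamic_monopoly_def)
  then have "finite {card M | M. dynamic_monopoly G \<tau> M}"
    using assms(1) finite_subset by blast
  then show ?thesis unfolding dyn_def using assms(2) by (auto intro: Min_le)
qed

lemma dyn_le_Max_degree_sum:
  assumes "graph G"
  shows "dyn G \<tau> \<le> Max {k \<in> {0..card (verts G)}.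
    (\<Sum>i = 1..k. real (deg_seq G i + 1)) \<le> real (card (verts G)) * avg_threshold G \<tau>}"
    (is "_ \<le> Max ?K")
proof -
  interpret graph G by fact
  obtain M where M: "dynamic_monopoly G \<tau> M"
    and le: "(\<Sum>v\<in>M. deg G v + 1) \<le> (\<Sum>v\<in>verts G. \<tau> v)"
    using exists_dynamic_monopoly_sum_deg_le[OF assms] by blast
  have sub: "M \<subseteq> verts G" using M by (simp add: dynamic_monopoly_def)
  have "real (\<Sum>i = 1..card M. deg_seq G i + 1) \<le> real (\<Sum>v\<in>verts G. \<tau> v)"
    using order_trans[OF sum_deg_seq_le_sum_deg[OF finite_verts sub] le] of_nat_le_iff by blast
  \<comment> \<open>For the empty graph the average is \<open>0 / 0 = 0\<close> and both sides
    vanish.\<close>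
  also have "\<dots> = real (card (verts G)) * avg_threshold G \<tau>"
    by (cases "verts G = {}") (simp_all add: avg_threshold_def)
  finally have "card M \<in> ?K"
    using sub by (simp add: card_mono)
  then have "card M \<le> Max ?K" by (intro Max_ge) auto
  then show ?thesis using dyn_le_card[OF finite_verts M] by linarith
qed

theorem theorem5:
  fixes G :: "('a, 'b) pre_digraph" and n :: nat
  assumes "graph G" and "card (verts G) = n"
  shows "(\<forall>\<tau>. threshold_assignment G \<tau> \<longrightarrow>
            dyn G \<tau> \<le> Max {k \<in> {0..n}.
              (\<Sum>i = 1..k. real (deg_seq G i + 1)) \<le> real n * avg_threshold G \<tau>})
       \<and> (\<forall>t :: real. (\<exists>\<tau>. threshold_assignment G \<tau> \<and> avg_threshold G \<tau> = t) \<longrightarrow>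
            Dyn G t \<le> Max {k \<in> {0..n}.
              (\<Sum>i = 1..k. real (deg_seq G i + 1)) \<le> real n * t})"
proof (intro conjI allI impI)
  fix \<tau>
  show "dyn G \<tau> \<le> Max {k \<in> {0..n}.
      (\<Sum>i = 1..k. real (deg_seq G i + 1)) \<le> real n * avg_threshold G \<tau>}"
    using dyn_le_Max_degree_sum[OF assms(1)] assms(2) by blast
next
  fix t :: real
  assume ex: "\<exists>\<tau>. threshold_assignment G \<tau> \<and> avg_threshold G \<tau> = t"
  let ?D = "{dyn G \<tau> | \<tau>. threshold_assignment G \<tau> \<and> avg_threshold G \<tau> = t}"
  let ?m = "Max {k \<in> {0..n}. (\<Sum>i = 1..k. real (deg_seq G i + 1)) \<le> real n * t}"
  have le: "\<forall>x\<in>?D. x \<le> ?m"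
    using dyn_le_Max_degree_sum[OF assms(1)] assms(2) by blast
  \<comment> \<open>The common bound makes this set of naturals finite, and \<open>ex\<close> makes
    it nonempty, so its \<open>Max\<close> is a genuine maximum.\<close>
  then have "finite ?D" using finite_nat_set_iff_bounded_le by blast
  then show "Dyn G t \<le> ?m"
    unfolding Dyn_def using le ex by (subst Max_le_iff) blast+
qed

end
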